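(* Let $\mathbb{K}$ be a field of characteristic zero, let $A\in\mathbb{K}^{n\times n}$, and suppose that the irreducible factorization $\chi_A(\lambda)=f_1(\lambda)^{m_1}\cdots f_q(\lambda)^{m_q}$ of its characteristic polynomial is given. Then Algorithm M (described in the context) outputs the exponents of the factors in the unit minimal annihilating polynomials of $A$: its output $(r_{i,j})_{1\le i\le q,\,1\le j\le n}$ satisfies $$\pi_{A,j}(\lambda)=f_1(\lambda)^{r_{1,j}}f_2(\lambda)^{r_{2,j}}\cdots f_q(\lambda)^{r_{q,j}}\qquad (j=1,\ldots,n).$$
   Context: Setting. $f_1,\ldots,f_q$ are the pairwise distinct monic irreducible factors of $\chi_A$ over $\mathbb{K}$, $m_p\ge1$, $g_p(\lambda)=\chi_A(\lambda)/f_p(\lambda)^{m_p}$. The $j$-th unit minimal annihilating polynomial $\pi_{A,j}$ is the monic generator of the ideal $\{p\in\mathbb{K}[\lambda]\mid p(A)\bm{e}_j=\bm{0}\}$, with $\bm{e}_j$ the $j$-th unit column vector. Algorithm P (unit pseudo annihilating polynomials). Generate a random (nonzero) row vector $\bm{u}\in\mathbb{K}^n$. For $i=1,\ldots,q$: compute $\bar{\bm{b}}=\bm{u}g_i(A)$; then for $k=0,1,\ldots,m_i-1$, for every $j$ whose exponent $\rho_{i,j}$ has not yet been set and for which the $j$-th entry of $\bar{\bm{b}}$ is $0$, set $\rho_{i,j}=k$, and then replace $\bar{\bm{b}}$ by $\bar{\bm{b}}f_i(A)$ (this loop is left as soon as, at the start of a pass, $\bar{\bm{b}}=\bm{0}$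 and all $\rho_{i,j}$, $1\le j\le n$, are set); finally set every still unset $\rho_{i,j}$ to $m_i$. Output $(\rho_{i,j})$. The polynomial $\pi'_{A,j}=\prod_{i=1}^q f_i^{\rho_{i,j}}$ is called a $j$-th unit pseudo annihilating polynomial; it divides $\pi_{A,j}$. Algorithm M (unit minimal annihilating polynomials). Compute $(\rho_{i,j})$ by Algorithm P and set $r_{i,j}\leftarrow\rho_{i,j}$ for all $i,j$. For each $j=1,\ldots,n$: (1) Compute $\bm{v}\leftarrow\pi'_{A,j}(A)\bm{e}_j$. If $\bm{v}=\bm{0}$, go to the next $j$. Otherwise set $\bm{v}_0\leftarrow\bm{v}$. (2) For $i=1,2,\ldots,q$: for $l=1,\ldots,m_i-\rho_{i,j}$ replace $\bm{v}\leftarrow f_i(A)\bm{v}$, and if now $\bm{v}=\bm{0}$, set $r_{i,j}\leftarrow\rho_{i,j}+l$ and $\bm{v}_i\leftarrow\bm{0}$, replace $\bm{v}_k\leftarrow f_i(A)^l\bm{v}_k$ for $k=i-1,\ldots,0$, and leave the loops over both $l$ and $i$, keeping the current value of $i$. If $\bm{v}\neq\bm{0}$ after the loop over $l$, set $\bm{v}_i\leftarrow\bm{v}$ and continue with the next $i$. (3) With $i$ the value at which step (2) stopped, for $k=i-1,\ldots,1$: set $\bm{v}\leftarrow\bm{v}_{k-1}$; for $l=0,1,\ldots,m_k-\rho_{k,j}-1$: if $\bm{v}=\bm{0}$, replace $\bm{v}_s\leftarrow f_k(A)^l\bm{v}_s$ for $s=k-2,\ldots,0$ and leave the loop over $l$;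 otherwise replace $\bm{v}\leftarrow f_k(A)\bm{v}$ and $r_{k,j}\leftarrow r_{k,j}+1$. Output $(r_{i,j})$.
   Formalization: In step (3) of Algorithm M the inner loop runs over l = 0,…,m_k−ρ_{k,j} instead of stopping at m_k−ρ_{k,j}−1; with the original bound the update of the v_s can be skipped and the output can be wrong for some nonzero u. The result is proved for every nonzero u. *)

theory Defs
  imports "Jordan_Normal_Form.Char_Poly"
begin

section \<open>Unit minimal annihilating polynomials\<close>

definition poly_mat :: "'a::comm_ring_1 poly \<Rightarrow> 'a mat \<Rightarrow> 'a mat" where
  "poly_mat p A = mat (dim_row A) (dim_row A)
     (\<lambda>(a, b). \<Sum>k\<le>degree p. coeff p k * (A ^\<^sub>m k) $$ (a, b))"

definition unit_annihilators :: "'a::field mat \<Rightarrow> nat \<Rightarrow> 'a poly set" where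
  "unit_annihilators A j =
     {p. poly_mat p A *\<^sub>v unit_vec (dim_row A) j = 0\<^sub>v (dim_row A)}"

text \<open>Columns are numbered from 0, as in the matrix library.\<close>

definition unit_min_annih_poly :: "'a::field mat \<Rightarrow> nat \<Rightarrow> 'a poly" where
  "unit_min_annih_poly A j =
     (THE p. lead_coeff p = 1 \<and> unit_annihilators A j = {p * s | s. True})"


section \<open>Loops with early exit\<close>

datatype 's flow = Continue (flow_state: 's) | Break (flow_state: 's)

text \<open>The result is \<open>Break s\<close> iff the body left the loop early; what happens then to an
  enclosing loop is up to the caller.\<close>

primrec for_loop :: "nat list \<Rightarrow> (nat \<Rightarrow> 's \<Rightarrow> 's flow) \<Rightarrow> 's \<Rightarrow> 's flow" where
  "for_loop [] body s = Continue s"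
| "for_loop (x # xs) body s =
     (case body x s of Break s' \<Rightarrow> Break s' | Continue s' \<Rightarrow> for_loop xs body s')"


section \<open>Unit pseudo annihilating polynomials\<close>

text \<open>The factors of the characteristic polynomial are \<open>f 1, \<dots>, f q\<close>, with multiplicities
  \<open>m 1, \<dots>, m q\<close>. A row vector \<open>b\<close> is multiplied by a matrix \<open>M\<close> as \<open>transpose_mat M *\<^sub>v b\<close>.
  In the loop state \<open>(b, \<rho>)\<close>, \<open>\<rho> j = None\<close> means that the exponent for column \<open>j\<close> has not
  yet been set.\<close>

definition cofactor :: "(nat \<Rightarrow> 'a::field poly) \<Rightarrow> (nat \<Rightarrow> nat) \<Rightarrow> 'a mat \<Rightarrow> nat \<Rightarrow> 'a poly" where
  "cofactor f m A i = char_poly A div f i ^ m i"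

definition pseudo_body ::
    "'a::field mat \<Rightarrow> nat \<Rightarrow> 'a vec \<times> (nat \<Rightarrow> nat option) \<Rightarrow> ('a vec \<times> (nat \<Rightarrow> nat option)) flow" where
  "pseudo_body F k s = (case s of (b, \<rho>) \<Rightarrow>
     if b = 0\<^sub>v (dim_row F) \<and> (\<forall>j<dim_row F. \<rho> j \<noteq> None) then Break (b, \<rho>)
     else Continue (transpose_mat F *\<^sub>v b,
            (\<lambda>j. if j < dim_row F \<and> \<rho> j = None \<and> b $ j = 0 then Some k else \<rho> j)))"

definition pseudo_exps ::
    "(nat \<Rightarrow> 'a::field poly) \<Rightarrow> (nat \<Rightarrow> nat) \<Rightarrow> 'a mat \<Rightarrow> 'a vec \<Rightarrow> nat \<Rightarrow> nat \<Rightarrow> nat" where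
  "pseudo_exps f m A u i j =
     (let b = transpose_mat (poly_mat (cofactor f m A i) A) *\<^sub>v u;
          s = flow_state (for_loop [0..<m i] (pseudo_body (poly_mat (f i) A)) (b, \<lambda>_. None))
      in case snd s j of Some k \<Rightarrow> k | None \<Rightarrow> m i)"

definition pseudo_poly ::
    "(nat \<Rightarrow> 'a::field poly) \<Rightarrow> nat \<Rightarrow> (nat \<Rightarrow> nat \<Rightarrow> nat) \<Rightarrow> nat \<Rightarrow> 'a poly" where
  "pseudo_poly f q \<rho> j = (\<Prod>i = 1..q. f i ^ \<rho> i j)"


section \<open>The algorithm for unit minimal annihilating polynomials\<close>

text \<open>State for a fixed column \<open>j\<close>: \<open>cur\<close> is $v$, \<open>saved k\<close> is $v_k$, \<open>expo i\<close> is $r_{i,j}$, and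
  \<open>stop\<close> is the value of $i$ at which step (2) is left. The arguments called \<open>\<rho>\<close> are the
  exponents $\rho_{i,j}$ for this \<open>j\<close>. Initially only $v_0$ is meaningful; every other $v_k$ is
  assigned before it is read.\<close>

record 'a annih_state =
  cur :: "'a vec"
  saved :: "nat \<Rightarrow> 'a vec"
  expo :: "nat \<Rightarrow> nat"
  stop :: nat

definition step2_inner ::
    "(nat \<Rightarrow> 'a::field poly) \<Rightarrow> 'a mat \<Rightarrow> (nat \<Rightarrow> nat) \<Rightarrow> nat \<Rightarrow>
     nat \<Rightarrow> 'a annih_state \<Rightarrow> 'a annih_state flow" where
  "step2_inner f A \<rho> i l s =
     (let F = poly_mat (f i) A; v = F *\<^sub>v cur s in
      if v = 0\<^sub>v (dim_row A) then
        Break (s\<lparr>cur := v,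
                 expo := (expo s)(i := \<rho> i + l),
                 saved := (\<lambda>k. if k = i then 0\<^sub>v (dim_row A)
                               else if k < i then (F ^\<^sub>m l) *\<^sub>v saved s k
                               else saved s k),
                 stop := i\<rparr>)
      else Continue (s\<lparr>cur := v\<rparr>))"

definition step2_outer ::
    "(nat \<Rightarrow> 'a::field poly) \<Rightarrow> (nat \<Rightarrow> nat) \<Rightarrow> 'a mat \<Rightarrow> (nat \<Rightarrow> nat) \<Rightarrow>
     nat \<Rightarrow> 'a annih_state \<Rightarrow> 'a annih_state flow" where
  "step2_outer f m A \<rho> i s =
     (case for_loop [1..<Suc (m i - \<rho> i)] (step2_inner f A \<rho> i) s of
        Break s' \<Rightarrow> Break s'
      | Continue s' \<Rightarrow>
          Continue (if cur s' \<noteq> 0\<^sub>v (dim_row A) then s'\<lparr>saved := (saved s')(i := cur s')\<rparr> else s'))"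

definition step3_inner ::
    "(nat \<Rightarrow> 'a::field poly) \<Rightarrow> 'a mat \<Rightarrow> nat \<Rightarrow>
     nat \<Rightarrow> 'a annih_state \<Rightarrow> 'a annih_state flow" where
  "step3_inner f A k l s =
     (let F = poly_mat (f k) A in
      if cur s = 0\<^sub>v (dim_row A) then
        Break (s\<lparr>saved := (\<lambda>t. if t < k - 1 then (F ^\<^sub>m l) *\<^sub>v saved s t else saved s t)\<rparr>)
      else Continue (s\<lparr>cur := F *\<^sub>v cur s, expo := (expo s)(k := expo s k + 1)\<rparr>))"

text \<open>The inner loop of step (3) runs over $l = 0, \dots, m_k - \rho_{k,j}$. The last index only
  matters when $v$ becomes zero in the very last multiplication, i.e. when $f_k$ has exponent
  $m_k$ in the result: this pass notices it and multiplies $f_k(A)^{m_k - \rho_{k,j}}$ into the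
  remaining $v_s$. If one stops at $m_k - \rho_{k,j} - 1$, these updates are skipped and the
  exponents of $f_{k-1}, \dots, f_1$ can come out too large: e.g. for the companion matrix of
  $(x-1)(x-2)$ extended by a zero row and column, $f = (x, x-1, x-2)$, $u = (0,0,1)$, the first
  column would get the exponents $(1,1,1)$ instead of $(0,1,1)$.\<close>

definition step3_outer ::
    "(nat \<Rightarrow> 'a::field poly) \<Rightarrow> (nat \<Rightarrow> nat) \<Rightarrow> 'a mat \<Rightarrow> (nat \<Rightarrow> nat) \<Rightarrow>
     nat \<Rightarrow> 'a annih_state \<Rightarrow> 'a annih_state flow" where
  "step3_outer f m A \<rho> k s =
     Continue (flow_state (for_loop [0..<Suc (m k - \<rho> k)] (step3_inner f A k)
                             (s\<lparr>cur := saved s (k - 1)\<rparr>)))"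

text \<open>If step (2) never stopped there would be no index to start step (3) from; since the
  characteristic polynomial annihilates \<open>A\<close> this does not occur, and step (3) is then skipped.\<close>

definition min_annih_column ::
    "(nat \<Rightarrow> 'a::field poly) \<Rightarrow> (nat \<Rightarrow> nat) \<Rightarrow> nat \<Rightarrow> 'a mat \<Rightarrow> (nat \<Rightarrow> nat \<Rightarrow> nat) \<Rightarrow> nat \<Rightarrow>
     nat \<Rightarrow> nat" where
  "min_annih_column f m q A R j =
     (let \<rho> = (\<lambda>i. R i j);
          v = poly_mat (pseudo_poly f q R j) A *\<^sub>v unit_vec (dim_row A) j
      in if v = 0\<^sub>v (dim_row A) then \<rho>
         else case for_loop [1..<Suc q] (step2_outer f m A \<rho>)
                     \<lparr>cur = v, saved = (\<lambda>_. v), expo = \<rho>, stop = 0\<rparr> of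
             Continue s \<Rightarrow> expo s
           | Break s \<Rightarrow> expo (flow_state
               (for_loop (rev [1..<stop s]) (step3_outer f m A \<rho>) s)))"

definition min_annih_exps ::
    "(nat \<Rightarrow> 'a::field poly) \<Rightarrow> (nat \<Rightarrow> nat) \<Rightarrow> nat \<Rightarrow> 'a mat \<Rightarrow> 'a vec \<Rightarrow> nat \<Rightarrow> nat \<Rightarrow> nat" where
  "min_annih_exps f m q A u i j = min_annih_column f m q A (pseudo_exps f m A u) j i"

end

theory Submission
  imports Defs
begin

text \<open>By the Cayley-Hamilton theorem, \<open>\<pi>\<^sub>A\<^sub>,\<^sub>j\<close> divides the characteristic polynomial, so
  \<open>\<pi>\<^sub>A\<^sub>,\<^sub>j = \<Prod>i. f\<^sub>i^e\<^sub>i\<close> with \<open>e\<^sub>i \<le> m\<^sub>i\<close>, and \<open>\<Prod>i. f\<^sub>i^d\<^sub>i\<close> annihilates the unit vector iff \<open>e \<le> d\<close>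
  pointwise. Since \<open>\<pi>\<^sub>A\<^sub>,\<^sub>j\<close> divides \<open>g\<^sub>i f\<^sub>i^e\<^sub>i\<close>, the pseudo exponents satisfy \<open>\<rho> \<le> e\<close>. Step (2) raises the
  exponents from \<open>\<rho>\<^sub>i\<close> to \<open>m\<^sub>i\<close> one factor at a time; the vector first vanishes in the pass for the
  largest \<open>i\<close> with \<open>\<rho>\<^sub>i < e\<^sub>i\<close>, after exactly \<open>e\<^sub>i - \<rho>\<^sub>i\<close> multiplications. When step (3) reaches \<open>k\<close>, its
  vector has exponents \<open>m\<^sub>t\<close> for \<open>t < k\<close>, \<open>\<rho>\<^sub>k\<close> for \<open>k\<close> and \<open>e\<^sub>t\<close> for \<open>t > k\<close>, so it vanishes after exactly
  \<open>e\<^sub>k - \<rho>\<^sub>k\<close> multiplications by \<open>f\<^sub>k(A)\<close>.\<close>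

section \<open>Polynomials in a matrix\<close>

lemma dim_poly_mat [simp]: "dim_row (poly_mat p A) = dim_row A" "dim_col (poly_mat p A) = dim_row A"
  by (simp_all add: poly_mat_def)

lemma poly_mat_carrier: "A \<in> carrier_mat n n \<Longrightarrow> poly_mat p A \<in> carrier_mat n n"
  by (simp add: poly_mat_def)

text \<open>Coefficients above the degree vanish, so polynomials of different degrees can be
  compared over one common range of summation.\<close>

lemma poly_mat_index:
  assumes "A \<in> carrier_mat n n" "a < n" "b < n" "degree p \<le> N"
  shows "poly_mat p A $$ (a, b) = (\<Sum>k\<le>N. coeff p k * (A ^\<^sub>m k) $$ (a, b))"
proof -
  have "poly_mat p A $$ (a, b) = (\<Sum>k\<le>degree p. coeff p k * (A ^\<^sub>m k) $$ (a, b))"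
    using assms by (simp add: poly_mat_def)
  also have "\<dots> = (\<Sum>k\<le>N. coeff p k * (A ^\<^sub>m k) $$ (a, b))"
    using assms(4) by (intro sum.mono_neutral_left) (auto simp: coeff_eq_0)
  finally show ?thesis .
qed

lemma poly_mat_0: "A \<in> carrier_mat n n \<Longrightarrow> poly_mat 0 A = 0\<^sub>m n n"
  by (intro eq_matI) (auto simp: poly_mat_def)

lemma poly_mat_add:
  assumes A: "A \<in> carrier_mat n n"
  shows "poly_mat (p + q) A = poly_mat p A + poly_mat q A"
proof (rule eq_matI)
  let ?N = "max (degree p) (degree q)"
  fix a b assume "a < dim_row (poly_mat p A + poly_mat q A)" "b < dim_col (poly_mat p A + poly_mat q A)"
  hence ab: "a < n" "b < n" using A by auto
  have "degree (p + q) \<le> ?N" by (rule degree_add_le_max)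
  thus "poly_mat (p + q) A $$ (a, b) = (poly_mat p A + poly_mat q A) $$ (a, b)"
    using A ab
    by (simp add: poly_mat_index[OF A ab, where N = ?N] distrib_right sum.distrib)
qed (use A in auto)

lemma poly_mat_smult:
  assumes A: "A \<in> carrier_mat n n"
  shows "poly_mat (Polynomial.smult c p) A = c \<cdot>\<^sub>m poly_mat p A"
proof (rule eq_matI)
  fix a b assume "a < dim_row (c \<cdot>\<^sub>m poly_mat p A)" "b < dim_col (c \<cdot>\<^sub>m poly_mat p A)"
  hence ab: "a < n" "b < n" using A by auto
  show "poly_mat (Polynomial.smult c p) A $$ (a, b) = (c \<cdot>\<^sub>m poly_mat p A) $$ (a, b)"
    using A ab
    by (simp add: poly_mat_index[OF A ab, where N = "degree p"] degree_smult_le sum_distrib_left mult.assoc)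
qed (use A in auto)

text \<open>Horner's rule, on which the inductions on polynomials below run.\<close>

lemma poly_mat_pCons:
  assumes A: "A \<in> carrier_mat n n"
  shows "poly_mat (pCons c p) A = c \<cdot>\<^sub>m 1\<^sub>m n + poly_mat p A * A"
proof (rule eq_matI)
  note P = poly_mat_carrier[OF A, of p]
  fix a b assume "a < dim_row (c \<cdot>\<^sub>m 1\<^sub>m n + poly_mat p A * A)" "b < dim_col (c \<cdot>\<^sub>m 1\<^sub>m n + poly_mat p A * A)"
  hence ab: "a < n" "b < n" using A by auto
  have pow: "(A ^\<^sub>m Suc k) $$ (a, b) = (\<Sum>x<n. (A ^\<^sub>m k) $$ (a, x) * A $$ (x, b))" for k
    using A ab by (auto simp: scalar_prod_def lessThan_atLeast0)
  have "(poly_mat p A * A) $$ (a, b) = (\<Sum>x<n. poly_mat p A $$ (a, x) * A $$ (x, b))"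
    using A P ab by (auto simp: scalar_prod_def lessThan_atLeast0)
  also have "\<dots> = (\<Sum>x<n. \<Sum>k\<le>degree p. coeff p k * ((A ^\<^sub>m k) $$ (a, x) * A $$ (x, b)))"
    by (intro sum.cong refl) (simp add: poly_mat_index[OF A ab(1) _ order_refl] sum_distrib_right mult.assoc)
  also have "\<dots> = (\<Sum>k\<le>degree p. coeff p k * (A ^\<^sub>m Suc k) $$ (a, b))"
    unfolding pow sum_distrib_left by (rule sum.swap)
  finally have *: "(poly_mat p A * A) $$ (a, b) = (\<Sum>k\<le>degree p. coeff p k * (A ^\<^sub>m Suc k) $$ (a, b))" .
  have "poly_mat (pCons c p) A $$ (a, b)
    = (\<Sum>k\<le>Suc (degree p). coeff (pCons c p) k * (A ^\<^sub>m k) $$ (a, b))"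
    by (rule poly_mat_index[OF A ab degree_pCons_le])
  also have "\<dots> = c * 1\<^sub>m n $$ (a, b) + (poly_mat p A * A) $$ (a, b)"
    using A unfolding * by (subst sum.atMost_Suc_shift) simp
  finally show "poly_mat (pCons c p) A $$ (a, b) = (c \<cdot>\<^sub>m 1\<^sub>m n + poly_mat p A * A) $$ (a, b)"
    using A P ab by simp
qed (use A in auto)

text \<open>Multiplicativity of evaluation rests on this, since Horner's rule leaves a factor
  \<open>A\<close> on the wrong side of \<open>poly_mat q A\<close>.\<close>

lemma poly_mat_commute_self:
  assumes A: "A \<in> carrier_mat n n"
  shows "A * poly_mat p A = poly_mat p A * A"
proof (induction p)
  case 0
  then show ?case
    using A by (simp add: poly_mat_0[OF A] left_mult_zero_mat[of _ n n] right_mult_zero_mat[of _ n n])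
next
  case (pCons c p)
  note P = poly_mat_carrier[OF A, of p]
  have C: "c \<cdot>\<^sub>m 1\<^sub>m n \<in> carrier_mat n n" by simp
  have PA: "poly_mat p A * A \<in> carrier_mat n n" using P A by (rule mult_carrier_mat)
  have "A * poly_mat (pCons c p) A = A * (c \<cdot>\<^sub>m 1\<^sub>m n) + A * (poly_mat p A * A)"
    unfolding poly_mat_pCons[OF A] by (rule mult_add_distrib_mat[OF A C PA])
  also have "A * (c \<cdot>\<^sub>m 1\<^sub>m n) = (c \<cdot>\<^sub>m 1\<^sub>m n) * A"
    using mult_smult_distrib[OF A one_carrier_mat, of c] mult_smult_assoc_mat[OF one_carrier_mat A, of c] A
    by simp
  also have "A * (poly_mat p A * A) = (poly_mat p A * A) * A"
    unfolding assoc_mult_mat[OF A P A, symmetric] pCons.IH ..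
  also have "(c \<cdot>\<^sub>m 1\<^sub>m n) * A + (poly_mat p A * A) * A = poly_mat (pCons c p) A * A"
    unfolding poly_mat_pCons[OF A] by (rule add_mult_distrib_mat[OF C PA A, symmetric])
  finally show ?case .
qed

lemma poly_mat_mult:
  assumes A: "A \<in> carrier_mat n n"
  shows "poly_mat (p * q) A = poly_mat p A * poly_mat q A"
proof (induction p)
  case 0
  then show ?case using poly_mat_carrier[OF A, of q]
    by (simp add: poly_mat_0[OF A] left_mult_zero_mat[of _ n n])
next
  case (pCons c p)
  note P = poly_mat_carrier[OF A, of p] and Q = poly_mat_carrier[OF A, of q]
  have "poly_mat (pCons c p * q) A = c \<cdot>\<^sub>m poly_mat q A + (0 \<cdot>\<^sub>m 1\<^sub>m n + poly_mat (p * q) A * A)"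
    by (simp add: poly_mat_add[OF A] poly_mat_smult[OF A] poly_mat_pCons[OF A])
  also have "0 \<cdot>\<^sub>m 1\<^sub>m n + poly_mat (p * q) A * A = poly_mat p A * (poly_mat q A * A)"
    using A P Q unfolding pCons.IH assoc_mult_mat[OF P Q A] by (intro eq_matI) auto
  also have "poly_mat q A * A = A * poly_mat q A"
    by (rule poly_mat_commute_self[OF A, symmetric])
  also have "poly_mat p A * (A * poly_mat q A) = (poly_mat p A * A) * poly_mat q A"
    by (rule assoc_mult_mat[OF P A Q, symmetric])
  also have "c \<cdot>\<^sub>m poly_mat q A = (c \<cdot>\<^sub>m 1\<^sub>m n) * poly_mat q A"
    unfolding mult_smult_assoc_mat[OF one_carrier_mat Q] left_mult_one_mat[OF Q] ..
  also have "(c \<cdot>\<^sub>m 1\<^sub>m n) * poly_mat q A + (poly_mat p A * A) * poly_mat q A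
    = poly_mat (pCons c p) A * poly_mat q A"
    unfolding poly_mat_pCons[OF A]
    by (rule add_mult_distrib_mat[OF _ mult_carrier_mat[OF P A] Q, symmetric]) simp
  finally show ?case .
qed

lemma poly_mat_sum_index:
  assumes "A \<in> carrier_mat n n" "finite S" "a < n" "b < n"
  shows "poly_mat (\<Sum>x\<in>S. g x) A $$ (a, b) = (\<Sum>x\<in>S. poly_mat (g x) A $$ (a, b))"
  using assms(2)
proof (induction S)
  case empty
  then show ?case using assms by (simp add: poly_mat_0)
next
  case (insert x S)
  then show ?case using assms poly_mat_carrier[OF assms(1), of "\<Sum>x\<in>S. g x"]
    by (simp add: poly_mat_add[OF assms(1)])
qed

text \<open>The polynomial vectors \<open>w\<close> are mapped to \<open>\<Sum>a. w\<^sub>a(A) e\<^sub>a\<close>. This map annihilates the columns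
  of \<open>\<lambda>I - A\<close>, hence those of \<open>(\<lambda>I - A) adj(\<lambda>I - A) = \<chi> I\<close>.\<close>

theorem Cayley_Hamilton:
  assumes A: "A \<in> carrier_mat n n"
  shows "poly_mat (char_poly A) A = 0\<^sub>m n n"
proof (rule eq_matI)
  define M where "M = char_poly_matrix A"
  define W where "W = adj_mat M"
  have M: "M \<in> carrier_mat n n" unfolding M_def using A by simp
  note W = adj_mat(1)[OF M, folded W_def]
  have MW: "M * W = char_poly A \<cdot>\<^sub>m 1\<^sub>m n"
    unfolding W_def char_poly_def M_def[symmetric] by (rule adj_mat(2)[OF M])
  have Mentry: "M $$ (a, b) = (if a = b then [:- A $$ (a, b), 1:] else [:- A $$ (a, b):])"
    if "a < n" "b < n" for a b
    using that A by (simp add: M_def char_poly_matrix_def)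
  \<comment> \<open>With delta the Kronecker symbol, the entry \<open>M $$ (a, b)\<close> evaluated
    at \<open>A\<close> is delta_ab A - A_ab I.\<close>
  have poly_M: "poly_mat (M $$ (a, b)) A $$ (c, a)
      = (if a = b then A $$ (c, b) else 0) - (if a = c then A $$ (a, b) else 0)"
    if "a < n" "b < n" "c < n" for a b c
    using that A by (auto simp: Mentry poly_mat_pCons[OF A] poly_mat_0[OF A])
  \<comment> \<open>Summed over \<open>a\<close>, each of the two Kronecker terms contributes
    \<open>A $$ (c, b)\<close>, and they cancel.\<close>
  have kill: "(\<Sum>a<n. poly_mat (M $$ (a, b)) A $$ (c, a)) = 0" if "b < n" "c < n" for b c
    using that by (simp add: poly_M sum_subtractf)
  fix r j assume "r < dim_row (0\<^sub>m n n :: 'a mat)" "j < dim_col (0\<^sub>m n n :: 'a mat)"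
  hence rj: "r < n" "j < n" by auto
  have prod: "(M * W) $$ (a, j) = (\<Sum>b<n. W $$ (b, j) * M $$ (a, b))" if "a < n" for a
    using that M W rj by (simp add: scalar_prod_def lessThan_atLeast0 mult.commute)
  have mult: "poly_mat (p * q) A $$ (r, a) = (\<Sum>c<n. poly_mat p A $$ (r, c) * poly_mat q A $$ (c, a))"
    if "a < n" for p q a
    using that rj A
    by (simp add: poly_mat_mult[OF A] scalar_prod_def lessThan_atLeast0)
  have "poly_mat (char_poly A) A $$ (r, j)
    = (\<Sum>a<n. if a = j then poly_mat (char_poly A) A $$ (r, a) else 0)"
    using rj by simp
  also have "\<dots> = (\<Sum>a<n. poly_mat ((M * W) $$ (a, j)) A $$ (r, a))"
    using rj by (intro sum.cong) (auto simp: MW poly_mat_0[OF A])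
  also have "\<dots> = (\<Sum>a<n. \<Sum>b<n. \<Sum>c<n. poly_mat (W $$ (b, j)) A $$ (r, c) * poly_mat (M $$ (a, b)) A $$ (c, a))"
    using rj by (intro sum.cong refl) (simp add: prod poly_mat_sum_index[OF A] mult)
  \<comment> \<open>The sum over \<open>a\<close> is moved innermost, where \<open>kill\<close>
    applies.\<close>
  also have "\<dots> = (\<Sum>b<n. \<Sum>a<n. \<Sum>c<n. poly_mat (W $$ (b, j)) A $$ (r, c) * poly_mat (M $$ (a, b)) A $$ (c, a))"
    by (rule sum.swap)
  also have "\<dots> = (\<Sum>b<n. \<Sum>c<n. \<Sum>a<n. poly_mat (W $$ (b, j)) A $$ (r, c) * poly_mat (M $$ (a, b)) A $$ (c, a))"
    by (intro sum.cong refl sum.swap)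
  also have "\<dots> = (\<Sum>b<n. \<Sum>c<n. poly_mat (W $$ (b, j)) A $$ (r, c) * (\<Sum>a<n. poly_mat (M $$ (a, b)) A $$ (c, a)))"
    by (simp add: sum_distrib_left)
  also have "\<dots> = 0"
    by (intro sum.neutral ballI) (simp add: kill)
  finally show "poly_mat (char_poly A) A $$ (r, j) = 0\<^sub>m n n $$ (r, j)" using rj by simp
qed (use A in auto)

section \<open>Products of powers of irreducible polynomials\<close>

text \<open>Induction on \<open>m\<close>: a factor \<open>p\<close> of \<open>g\<close> is split
  off; if there is none, primality puts \<open>p\<close> into the complementary divisor and one
  \<open>p\<close> cancels.\<close>

lemma dvd_prime_power_mult:
  fixes p :: "'a::algebraic_semidom"
  assumes "prime_elem p" "g dvd p ^ m * h"
  shows "\<exists>k g'. k \<le> m \<and> g = p ^ k * g' \<and> g' dvd h"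
  using assms(2)
proof (induction m arbitrary: g)
  case 0
  then show ?case by auto
next
  case (Suc m)
  have p0: "p \<noteq> 0" using assms(1) by auto
  show ?case
  proof (cases "p dvd g")
    case True
    then obtain g1 where g1: "g = p * g1" by blast
    hence "g1 dvd p ^ m * h" using Suc.prems p0 by (simp add: mult.assoc)
    from Suc.IH[OF this] obtain k g' where "k \<le> m" "g1 = p ^ k * g'" "g' dvd h" by blast
    thus ?thesis using g1 by (intro exI[of _ "Suc k"]) (auto simp: mult.assoc)
  next
    case False
    from Suc.prems obtain c where c: "p ^ Suc m * h = g * c" by blast
    hence "p dvd g * c" by (metis dvd_mult2 dvd_triv_left power_Suc)
    hence "p dvd c" using assms(1) False by (simp add: prime_elem_dvd_mult_iff)
    then obtain c' where "c = p * c'" by blast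
    hence "p * (p ^ m * h) = p * (g * c')" using c by (simp add: ac_simps)
    hence "p ^ m * h = g * c'" using p0 by simp
    hence "g dvd p ^ m * h" by simp
    from Suc.IH[OF this] show ?thesis using le_SucI by blast
  qed
qed

text \<open>One prime power is split off at a time. The quotient stays monic, so at the end it is 1
  and not just a unit.\<close>

lemma monic_dvd_prod_powers:
  fixes f :: "'b \<Rightarrow> 'a::field poly"
  assumes "finite S" "\<And>i. i \<in> S \<Longrightarrow> monic (f i)" "\<And>i. i \<in> S \<Longrightarrow> irreducible (f i)"
    and "monic g" "g dvd (\<Prod>i\<in>S. f i ^ m i)"
  shows "\<exists>e. (\<forall>i\<in>S. e i \<le> m i) \<and> g = (\<Prod>i\<in>S. f i ^ e i)"
  using assms
proof (induction S arbitrary: g)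
  case empty
  then show ?case by (simp add: monic_degree_0[symmetric] poly_dvd_1)
next
  case (insert i S)
  have "prime_elem (f i)" using insert.prems by (simp add: field_poly_irreducible_imp_prime)
  moreover have "g dvd f i ^ m i * (\<Prod>i\<in>S. f i ^ m i)" using insert by simp
  ultimately obtain k g' where k: "k \<le> m i" "g = f i ^ k * g'" "g' dvd (\<Prod>i\<in>S. f i ^ m i)"
    using dvd_prime_power_mult by blast
  have "monic g'" using insert.prems k(2) by (simp add: lead_coeff_mult lead_coeff_power)
  then obtain e where e: "\<forall>i\<in>S. e i \<le> m i" "g' = (\<Prod>i\<in>S. f i ^ e i)"
    using insert.IH[of g'] insert.prems k(3) by auto
  have "(\<Prod>t\<in>S. f t ^ (e(i := k)) t) = g'"
    unfolding e(2) using insert.hyps by (intro prod.cong) auto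
  hence "g = (\<Prod>t\<in>insert i S. f t ^ (e(i := k)) t)"
    unfolding prod.insert[OF insert.hyps] k(2) by simp
  moreover have "\<forall>t\<in>insert i S. (e(i := k)) t \<le> m t" using e(1) k(1) by simp
  ultimately show ?case by blast
qed

lemma prime_elem_dvd_prod:
  assumes "finite S" "prime_elem p" "p dvd (\<Prod>i\<in>S. g i)"
  shows "\<exists>i\<in>S. p dvd g i"
  using assms(1,3)
proof (induction S)
  case empty
  then show ?case using assms(2) by (simp add: prime_elem_def)
next
  case (insert i S)
  then show ?case using assms(2) by (auto simp: prime_elem_dvd_mult_iff)
qed

text \<open>If \<open>e i > d i\<close>, cancelling \<open>f i ^ d i\<close> leaves
  \<open>f i\<close> dividing the product of the other powers, hence some other \<open>f t\<close>.
  Both are monic and irreducible, so they coincide, against injectivity.\<close>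

lemma prod_powers_dvd_iff:
  fixes f :: "'b \<Rightarrow> 'a::field poly"
  assumes S: "finite S" and monic: "\<And>i. i \<in> S \<Longrightarrow> monic (f i)"
    and irred: "\<And>i. i \<in> S \<Longrightarrow> irreducible (f i)" and inj: "inj_on f S"
  shows "(\<Prod>i\<in>S. f i ^ e i) dvd (\<Prod>i\<in>S. f i ^ d i) \<longleftrightarrow> (\<forall>i\<in>S. e i \<le> d i)"
proof
  assume dvd: "(\<Prod>i\<in>S. f i ^ e i) dvd (\<Prod>i\<in>S. f i ^ d i)"
  show "\<forall>i\<in>S. e i \<le> d i"
  proof (rule ballI, rule ccontr)
    fix i assume i: "i \<in> S" and "\<not> e i \<le> d i"
    hence le: "Suc (d i) \<le> e i" by simp
    have prime: "prime_elem (f i)" using irred[OF i] by (rule field_poly_irreducible_imp_prime)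
    have "f i ^ Suc (d i) dvd f i ^ e i" by (rule le_imp_power_dvd[OF le])
    also have "\<dots> dvd (\<Prod>i\<in>S. f i ^ e i)" using S i by (rule dvd_prodI)
    also have "\<dots> dvd (\<Prod>i\<in>S. f i ^ d i)" by (rule dvd)
    also have "\<dots> = f i ^ d i * (\<Prod>t\<in>S - {i}. f t ^ d t)" using S i by (rule prod.remove)
    finally have "f i ^ d i * f i dvd f i ^ d i * (\<Prod>t\<in>S - {i}. f t ^ d t)"
      by (simp add: mult.commute)
    hence "f i dvd (\<Prod>t\<in>S - {i}. f t ^ d t)"
      using prime by (subst (asm) dvd_mult_cancel_left) auto
    then obtain t where t: "t \<in> S - {i}" "f i dvd f t ^ d t"
      using prime_elem_dvd_prod[of "S - {i}"] S prime by blast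
    hence "f i dvd f t" using prime_elem_dvd_power[OF prime] by blast
    hence "f i = f t"
      using irred[of t] irred[OF i] monic[of t] monic[OF i] t(1) by (simp add: irreducible\<^sub>d_dvd_eq)
    thus False using inj i t(1) by (auto dest: inj_onD)
  qed
next
  assume "\<forall>i\<in>S. e i \<le> d i"
  thus "(\<Prod>i\<in>S. f i ^ e i) dvd (\<Prod>i\<in>S. f i ^ d i)"
    by (intro prod_dvd_prod) (auto intro: le_imp_power_dvd)
qed

section \<open>The ideal of unit annihilators\<close>

lemma unit_annihilators_mult:
  assumes A: "A \<in> carrier_mat n n" and p: "p \<in> unit_annihilators A j"
  shows "s * p \<in> unit_annihilators A j"
proof -
  have "poly_mat (s * p) A *\<^sub>v unit_vec n j = poly_mat s A *\<^sub>v (poly_mat p A *\<^sub>v unit_vec n j)"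
    using A by (simp add: poly_mat_mult[OF A] assoc_mult_mat_vec[of _ n n _ n] poly_mat_carrier)
  also have "poly_mat p A *\<^sub>v unit_vec n j = 0\<^sub>v n"
    using p A by (simp add: unit_annihilators_def)
  also have "poly_mat s A *\<^sub>v 0\<^sub>v n = 0\<^sub>v n"
    using A by (intro eq_vecI) (auto simp: scalar_prod_def)
  finally show ?thesis using A by (simp add: unit_annihilators_def)
qed

lemma unit_annihilators_add:
  assumes A: "A \<in> carrier_mat n n" and p: "p \<in> unit_annihilators A j" "q \<in> unit_annihilators A j"
  shows "p + q \<in> unit_annihilators A j"
  using assms
  by (simp add: unit_annihilators_def poly_mat_add[OF A] add_mult_distrib_mat_vec[of _ n n] poly_mat_carrier)

lemma char_poly_unit_annihilators:
  assumes A: "A \<in> carrier_mat n n"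
  shows "char_poly A \<in> unit_annihilators A j"
  using A by (auto simp: unit_annihilators_def Cayley_Hamilton intro!: eq_vecI)

text \<open>Division with remainder: a nonzero annihilator of least degree divides all others. One
  exists because of \<open>char_poly A\<close>, and scaling makes it monic.\<close>

lemma unit_annihilators_generator:
  assumes A: "A \<in> carrier_mat n n"
  obtains g where "monic g" "\<And>p. p \<in> unit_annihilators A j \<longleftrightarrow> g dvd p"
proof -
  define I where "I = unit_annihilators A j"
  have "char_poly A \<noteq> 0" using degree_monic_char_poly[OF A] by auto
  hence "char_poly A \<in> I \<and> char_poly A \<noteq> 0"
    using char_poly_unit_annihilators[OF A] by (simp add: I_def)
  then obtain h where h: "h \<in> I" "h \<noteq> 0" and least: "\<And>p. p \<in> I \<Longrightarrow> p \<noteq> 0 \<Longrightarrow> degree h \<le> degree p"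
    using ex_has_least_nat[of "\<lambda>p. p \<in> I \<and> p \<noteq> 0" _ degree] by blast
  have "h dvd p" if p: "p \<in> I" for p
  proof -
    have "p mod h = p + (- (p div h)) * h" by (simp add: minus_div_mult_eq_mod[symmetric])
    also have "\<dots> \<in> I"
      using p h(1) unfolding I_def by (intro unit_annihilators_add[OF A] unit_annihilators_mult[OF A])
    finally have "p mod h \<in> I" .
    hence "p mod h = 0" using least[of "p mod h"] degree_mod_less[OF h(2), of p] by linarith
    thus ?thesis by (simp add: dvd_eq_mod_eq_0)
  qed
  moreover have "p \<in> I" if "h dvd p" for p
    using that unit_annihilators_mult[OF A] h(1) by (auto simp: I_def mult.commute elim!: dvdE)
  ultimately have "p \<in> I \<longleftrightarrow> Polynomial.smult (inverse (lead_coeff h)) h dvd p" for p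
    using h(2) by (auto simp: smult_dvd_iff)
  moreover have "monic (Polynomial.smult (inverse (lead_coeff h)) h)" using h(2) by simp
  ultimately show ?thesis using that unfolding I_def by blast
qed

text \<open>Two monic generators divide each other and hence agree, so the definite description
  denotes \<open>g\<close>.\<close>

lemma unit_min_annih_poly_eqI:
  assumes "monic g" "\<And>p. p \<in> unit_annihilators A j \<longleftrightarrow> g dvd p"
  shows "unit_min_annih_poly A j = g"
  unfolding unit_min_annih_poly_def
proof (rule the_equality)
  have dvds: "{p * s | s. True} = {x. p dvd x}" for p :: "'a poly" by (auto simp: dvd_def)
  show "monic g \<and> unit_annihilators A j = {g * s | s. True}"
    using assms unfolding dvds by blast
  fix p assume "monic p \<and> unit_annihilators A j = {p * s | s. True}"
  hence "monic p" "\<And>x. g dvd x \<longleftrightarrow> p dvd x" using assms(2) unfolding dvds by blast+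
  moreover from this(2)[of p] this(2)[of g] have "p dvd g" "g dvd p" by simp_all
  ultimately show "p = g" using assms(1) poly_dvd_antisym[of p g] by simp
qed

section \<open>Loops over index ranges\<close>

lemma for_loop_append:
  "for_loop (xs @ ys) body s =
     (case for_loop xs body s of Break t \<Rightarrow> Break t | Continue t \<Rightarrow> for_loop ys body t)"
  by (induction xs arbitrary: s) (auto split: flow.splits)

text \<open>\<open>S\<close> is an explicit trace: \<open>S k\<close> is the state in which the pass
  for \<open>k\<close> begins.\<close>

lemma for_loop_upt_continue:
  assumes "a \<le> b" "\<And>k. a \<le> k \<Longrightarrow> k < b \<Longrightarrow> body k (S k) = Continue (S (Suc k))"
  shows "for_loop [a..<b] body (S a) = Continue (S b)"
  using assms by (induction b rule: dec_induct) (auto simp: for_loop_append upt_Suc_append)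

lemma for_loop_upt_break:
  assumes "a \<le> l" "l < b" "\<And>k. a \<le> k \<Longrightarrow> k < l \<Longrightarrow> body k (S k) = Continue (S (Suc k))"
    and "body l (S l) = Break t"
  shows "for_loop [a..<b] body (S a) = Break t"
proof -
  have "[a..<b] = [a..<l] @ [l..<b]" using upt_add_eq_append[of a l "b - l"] assms(1,2) by simp
  also have "[l..<b] = l # [Suc l..<b]" using assms(2) by (rule upt_conv_Cons)
  finally show ?thesis
    using for_loop_upt_continue[where S = S and body = body, OF assms(1,3)] assms(4) by (simp add: for_loop_append)
qed

text \<open>\<open>P k\<close> holds before pass \<open>k\<close>, while \<open>Q\<close> is what is
  known about a state left by an early exit.\<close>

lemma for_loop_upt_invariant:
  assumes "a \<le> b" "P a s"
    and "\<And>k s. a \<le> k \<Longrightarrow> k < b \<Longrightarrow> P k s \<Longrightarrow>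
           (case body k s of Continue t \<Rightarrow> P (Suc k) t | Break t \<Rightarrow> Q t)"
  shows "case for_loop [a..<b] body s of Continue t \<Rightarrow> P b t | Break t \<Rightarrow> Q t"
  using assms
proof (induction b rule: dec_induct)
  case (step b)
  have IH: "case for_loop [a..<b] body s of Continue t \<Rightarrow> P b t | Break t \<Rightarrow> Q t"
    using step.prems by (intro step.IH) auto
  show ?case
  proof (cases "for_loop [a..<b] body s")
    case (Continue t)
    have "P b t" using IH Continue by simp
    hence "case body b t of Continue t \<Rightarrow> P (Suc b) t | Break t \<Rightarrow> Q t"
      using step.prems(2) step.hyps by simp
    thus ?thesis using step.hyps Continue
      by (simp add: for_loop_append upt_Suc_append split: flow.splits)
  next
    case (Break t)
    thus ?thesis using IH step.hyps by (simp add: for_loop_append upt_Suc_append)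
  qed
qed simp

text \<open>Made for the descending loop of step (3), whose body never exits early;
  \<open>P (Suc k)\<close> holds before pass \<open>k\<close>.\<close>

lemma for_loop_rev_upt_invariant:
  assumes "a \<le> b" "P b s"
    and "\<And>k s. a \<le> k \<Longrightarrow> k < b \<Longrightarrow> P (Suc k) s \<Longrightarrow> \<exists>t. body k s = Continue t \<and> P k t"
  shows "\<exists>t. for_loop (rev [a..<b]) body s = Continue t \<and> P a t"
  using assms
proof (induction b arbitrary: s rule: dec_induct)
  case (step b)
  then obtain t where "body b s = Continue t" "P b t" by blast
  moreover have "\<exists>t'. for_loop (rev [a..<b]) body t = Continue t' \<and> P a t'"
    using step.prems \<open>P b t\<close> by (intro step.IH) auto
  ultimately show ?case using step.hyps by (simp add: upt_Suc_append)
qed simp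

section \<open>The computation for one column\<close>

text \<open>\<open>V d\<close> stands for \<open>(\<Prod>i. f\<^sub>i(A)^d\<^sub>i) e\<^sub>j\<close>, and \<open>e\<close> for the exponents of \<open>\<pi>\<^sub>A\<^sub>,\<^sub>j\<close>: all that the
  algorithm learns about \<open>A\<close> is which of these vectors vanish.\<close>

locale column_exponents =
  fixes f :: "nat \<Rightarrow> 'a::field poly" and A :: "'a mat" and m :: "nat \<Rightarrow> nat" and q n :: nat
    and \<rho> e :: "nat \<Rightarrow> nat" and V :: "(nat \<Rightarrow> nat) \<Rightarrow> 'a vec"
  assumes A: "A \<in> carrier_mat n n"
    and V_carrier: "V d \<in> carrier_vec n"
    and V_step: "i \<in> {1..q} \<Longrightarrow> poly_mat (f i) A *\<^sub>v V d = V (d(i := Suc (d i)))"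
    and V_cong: "(\<And>i. i \<in> {1..q} \<Longrightarrow> d i = d' i) \<Longrightarrow> V d = V d'"
    and V_zero: "V d = 0\<^sub>v n \<longleftrightarrow> (\<forall>i\<in>{1..q}. e i \<le> d i)"
    and rho_le: "i \<in> {1..q} \<Longrightarrow> \<rho> i \<le> e i"
    and le_mult: "i \<in> {1..q} \<Longrightarrow> e i \<le> m i"
begin

lemma dim_A [simp]: "dim_row A = n"
  using A by auto

lemma V_power:
  assumes "i \<in> {1..q}"
  shows "(poly_mat (f i) A ^\<^sub>m l) *\<^sub>v V d = V (d(i := d i + l))"
proof (induction l arbitrary: d)
  case 0
  have "1\<^sub>m n *\<^sub>v V d = V d" using V_carrier by (rule one_mult_mat_vec)
  then show ?case by simp
next
  case (Suc l)
  have F: "poly_mat (f i) A \<in> carrier_mat n n" using A by (rule poly_mat_carrier)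
  have "(poly_mat (f i) A ^\<^sub>m Suc l) *\<^sub>v V d = (poly_mat (f i) A ^\<^sub>m l) *\<^sub>v (poly_mat (f i) A *\<^sub>v V d)"
    using assoc_mult_mat_vec[OF pow_carrier_mat[OF F] F V_carrier] by simp
  also have "\<dots> = V (d(i := Suc (d i) + l))"
    by (simp only: V_step[OF assms] Suc.IH fun_upd_same fun_upd_upd)
  finally show ?case by (simp add: fun_upd_def)
qed

text \<open>Through this, the zero tests inside the loops over \<open>l\<close> become comparisons
  of a single exponent with \<open>e i\<close>.\<close>

lemma V_upd_zero:
  assumes "i \<in> {1..q}" "\<forall>t\<in>{1..q} - {i}. e t \<le> d t"
  shows "V (d(i := x)) = 0\<^sub>v n \<longleftrightarrow> e i \<le> x"
  using assms unfolding V_zero by auto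

section \<open>Step (2) for one column\<close>

lemma step2_inner_break:
  assumes i: "i \<in> {1..q}" and "cur s = V d" "d i = \<rho> i" "\<forall>t\<in>{1..q} - {i}. e t \<le> d t" "\<rho> i < e i"
  shows "for_loop [1..<Suc (m i - \<rho> i)] (step2_inner f A \<rho> i) s =
    Break (s\<lparr>cur := 0\<^sub>v n, expo := (expo s)(i := e i),
             saved := (\<lambda>k. if k = i then 0\<^sub>v n
                           else if k < i then (poly_mat (f i) A ^\<^sub>m (e i - \<rho> i)) *\<^sub>v saved s k
                           else saved s k),
             stop := i\<rparr>)" (is "_ = Break ?t")
proof -
  \<comment> \<open>The loop starts at 1 and multiplies before testing, so \<open>l - 1\<close>
    multiplications precede pass \<open>l\<close>.\<close>
  define S where "S l = s\<lparr>cur := V (d(i := \<rho> i + (l - 1)))\<rparr>" for l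
  note zero = V_upd_zero[OF assms(1,4)]
  have "for_loop [1..<Suc (m i - \<rho> i)] (step2_inner f A \<rho> i) (S 1) = Break ?t"
  proof (rule for_loop_upt_break)
    \<comment> \<open>The vector vanishes in pass \<open>e i - \<rho> i\<close>, which lies in the
      range because \<open>\<rho> i < e i\<close> and \<open>e i \<le> m i\<close>.\<close>
    show "1 \<le> e i - \<rho> i" "e i - \<rho> i < Suc (m i - \<rho> i)" using assms(5) le_mult[OF i] by auto
    show "step2_inner f A \<rho> i k (S k) = Continue (S (Suc k))" if "1 \<le> k" "k < e i - \<rho> i" for k
      using that by (simp add: step2_inner_def S_def Let_def V_step[OF i] zero)
    show "step2_inner f A \<rho> i (e i - \<rho> i) (S (e i - \<rho> i)) = Break ?t"
      using assms(5) zero[of "e i"]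
      by (simp add: step2_inner_def S_def Let_def V_step[OF i] cong: if_cong)
  qed
  moreover have "S 1 = s" using assms(2,3) by (simp add: S_def fun_upd_idem)
  ultimately show ?thesis by simp
qed

text \<open>Another exponent is too small, so no power of \<open>f i\<close> makes the vector vanish
  and all passes run.\<close>

lemma step2_inner_continue:
  assumes i: "i \<in> {1..q}" and "cur s = V d" "d i = \<rho> i" "\<exists>t\<in>{1..q} - {i}. d t < e t"
  shows "for_loop [1..<Suc (m i - \<rho> i)] (step2_inner f A \<rho> i) s = Continue (s\<lparr>cur := V (d(i := m i))\<rparr>)"
proof -
  define S where "S l = s\<lparr>cur := V (d(i := \<rho> i + (l - 1)))\<rparr>" for l
  have nonzero: "V (d(i := x)) \<noteq> 0\<^sub>v n" for x
    using assms(4) unfolding V_zero by force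
  have "for_loop [1..<Suc (m i - \<rho> i)] (step2_inner f A \<rho> i) (S 1) = Continue (S (Suc (m i - \<rho> i)))"
    by (rule for_loop_upt_continue)
       (simp_all add: step2_inner_def S_def Let_def V_step[OF i] nonzero)
  moreover have "S 1 = s" using assms(2,3) by (simp add: S_def fun_upd_idem)
  moreover have "\<rho> i + (m i - \<rho> i) = m i" using rho_le[OF i] le_mult[OF i] by simp
  ultimately show ?thesis by (simp add: S_def)
qed

text \<open>The exponents of the vector v_k that step (2) saves after the pass for
  \<open>k\<close>.\<close>

definition full_upto :: "nat \<Rightarrow> nat \<Rightarrow> nat" where
  "full_upto k = (\<lambda>t. if 1 \<le> t \<and> t \<le> k then m t else \<rho> t)"

text \<open>The break multiplies the missing \<open>e i - \<rho> i\<close> factors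
  \<open>f i\<close> into the saved vectors, so their exponent of \<open>f i\<close> is already
  final when step (3) starts.\<close>

lemma step2_stops:
  assumes "V \<rho> \<noteq> 0\<^sub>v n"
  obtains i s where
    "for_loop [1..<Suc q] (step2_outer f m A \<rho>) \<lparr>cur = V \<rho>, saved = (\<lambda>_. V \<rho>), expo = \<rho>, stop = 0\<rparr> = Break s"
    "i \<in> {1..q}" "stop s = i" "\<And>t. t \<in> {1..q} \<Longrightarrow> i < t \<Longrightarrow> e t = \<rho> t" "expo s = \<rho>(i := e i)"
    "\<And>k. k < i \<Longrightarrow> saved s k = V ((full_upto k)(i := e i))"
proof -
  define i where "i = Max {t \<in> {1..q}. \<rho> t < e t}"
  obtain t where "t \<in> {1..q}" "\<rho> t < e t"
    using assms unfolding V_zero by (metis not_le)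
  hence "{t \<in> {1..q}. \<rho> t < e t} \<noteq> {}" by blast
  hence "i \<in> {t \<in> {1..q}. \<rho> t < e t}" unfolding i_def by (intro Max_in) auto
  hence i: "i \<in> {1..q}" "\<rho> i < e i" by auto
  have after: "e t = \<rho> t" if "t \<in> {1..q}" "i < t" for t
  proof (rule ccontr)
    assume "e t \<noteq> \<rho> t"
    hence "t \<le> i" unfolding i_def using that(1) rho_le[OF that(1)] by (intro Max_ge) auto
    thus False using that(2) by simp
  qed
  \<comment> \<open>The state before pass \<open>k\<close>; entries of \<open>saved\<close> from
    \<open>k\<close> on still hold the initial \<open>V \<rho>\<close>.\<close>
  define S where "S k = \<lparr>cur = V (full_upto (k - 1)),
    saved = (\<lambda>t. if t \<le> k - 1 then V (full_upto t) else V \<rho>), expo = \<rho>, stop = 0\<rparr>" for k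
  have full_Suc: "(full_upto (k - 1))(k := m k) = full_upto k" if "1 \<le> k" for k
    using that by (auto simp: full_upto_def fun_eq_iff)
  have full_0: "full_upto 0 = \<rho>" by (auto simp: full_upto_def)
  have continue: "step2_outer f m A \<rho> k (S k) = Continue (S (Suc k))" if k: "1 \<le> k" "k < i" for k
  proof -
    have "for_loop [1..<Suc (m k - \<rho> k)] (step2_inner f A \<rho> k) (S k)
      = Continue ((S k)\<lparr>cur := V (full_upto k)\<rparr>)"
      unfolding full_Suc[OF k(1), symmetric]
    proof (rule step2_inner_continue)
      \<comment> \<open>For \<open>k < i\<close> the exponent of \<open>f i\<close> is still
        \<open>\<rho> i\<close>, which is too small.\<close>
      show "\<exists>t\<in>{1..q} - {k}. full_upto (k - 1) t < e t"
        using k i by (intro bexI[of _ i]) (auto simp: full_upto_def)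
    qed (use k i in \<open>auto simp: S_def full_upto_def\<close>)
    moreover have "V (full_upto k) \<noteq> 0\<^sub>v n"
      unfolding V_zero using k i by (auto intro!: bexI[of _ i] simp: full_upto_def)
    ultimately show ?thesis
      using k by (auto simp: step2_outer_def S_def fun_eq_iff)
  qed
  define s where "s = (S i)\<lparr>cur := 0\<^sub>v n, expo := (expo (S i))(i := e i),
             saved := (\<lambda>k. if k = i then 0\<^sub>v n
                           else if k < i then (poly_mat (f i) A ^\<^sub>m (e i - \<rho> i)) *\<^sub>v saved (S i) k
                           else saved (S i) k),
             stop := i\<rparr>"
  have "for_loop [1..<Suc (m i - \<rho> i)] (step2_inner f A \<rho> i) (S i) = Break s"
    unfolding s_def
  proof (rule step2_inner_break)
    \<comment> \<open>Earlier factors have exponent \<open>m t\<close>, later ones need only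
      \<open>\<rho> t\<close>, so vanishing depends on \<open>f i\<close> alone.\<close>
    show "\<forall>t\<in>{1..q} - {i}. e t \<le> full_upto (i - 1) t"
      using after le_mult by (auto simp: full_upto_def)
  qed (use i in \<open>auto simp: S_def full_upto_def\<close>)
  hence "step2_outer f m A \<rho> i (S i) = Break s"
    by (simp add: step2_outer_def)
  hence "for_loop [1..<Suc q] (step2_outer f m A \<rho>) (S 1) = Break s"
    using i continue by (intro for_loop_upt_break[where l = i]) auto
  moreover have "S 1 = \<lparr>cur = V \<rho>, saved = (\<lambda>_. V \<rho>), expo = \<rho>, stop = 0\<rparr>"
    by (auto simp: S_def full_0)
  moreover have "saved s k = V ((full_upto k)(i := e i))" if "k < i" for k
  proof -
    have "k \<le> i - 1" using that by simp
    thus ?thesis using that i by (simp add: s_def S_def V_power[OF i(1)] full_upto_def)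
  qed
  moreover have "stop s = i" "expo s = \<rho>(i := e i)" by (simp_all add: s_def S_def)
  ultimately show ?thesis using i(1) after by (intro that[of s i]) simp_all
qed

section \<open>Step (3) for one column\<close>

lemma step3_inner_loop:
  assumes k: "k \<in> {1..q}" and "cur s = V d" "d k = \<rho> k" "expo s k = \<rho> k" "\<forall>t\<in>{1..q} - {k}. e t \<le> d t"
  shows "for_loop [0..<Suc (m k - \<rho> k)] (step3_inner f A k) s =
    Break (s\<lparr>cur := 0\<^sub>v n, expo := (expo s)(k := e k),
      saved := (\<lambda>t. if t < k - 1 then (poly_mat (f k) A ^\<^sub>m (e k - \<rho> k)) *\<^sub>v saved s t else saved s t)\<rparr>)"
    (is "_ = Break ?t")
proof -
  define S where "S l = s\<lparr>cur := V (d(k := \<rho> k + l)), expo := (expo s)(k := \<rho> k + l)\<rparr>" for l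
  note zero = V_upd_zero[OF assms(1,5)]
  have "for_loop [0..<Suc (m k - \<rho> k)] (step3_inner f A k) (S 0) = Break ?t"
  proof (rule for_loop_upt_break)
    \<comment> \<open>Here the test precedes the multiplication, so the zero is noticed in pass
      \<open>e k - \<rho> k\<close>; if \<open>e k = m k\<close>, this is the last index of the
      range.\<close>
    show "0 \<le> e k - \<rho> k" "e k - \<rho> k < Suc (m k - \<rho> k)" using le_mult[OF k] by auto
    show "step3_inner f A k l (S l) = Continue (S (Suc l))" if "0 \<le> l" "l < e k - \<rho> k" for l
      using that by (simp add: step3_inner_def S_def Let_def V_step[OF k] zero)
    show "step3_inner f A k (e k - \<rho> k) (S (e k - \<rho> k)) = Break ?t"
      using rho_le[OF k] zero[of "e k"]
      by (simp add: step3_inner_def S_def Let_def cong: if_cong)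
  qed
  moreover have "S 0 = s" using assms(2-4) by (simp add: S_def fun_upd_idem)
  ultimately show ?thesis by simp
qed

text \<open>Before the pass of step (3) for \<open>k - 1\<close>, the exponents of \<open>f\<^sub>k, \<dots>, f\<^sub>q\<close> are known and already
  multiplied into those \<open>v\<^sub>t\<close> which are still to be read.\<close>

definition step3_invariant :: "nat \<Rightarrow> 'a annih_state \<Rightarrow> bool" where
  "step3_invariant k s \<longleftrightarrow>
     (\<forall>t. Suc t < k \<longrightarrow> saved s t = V (\<lambda>x. if x < k then full_upto t x else e x)) \<and>
     (\<forall>x\<in>{1..q}. expo s x = (if x < k then \<rho> x else e x))"

lemma step3_outer_invariant:
  assumes k: "k \<in> {1..q}" and inv: "step3_invariant (Suc k) s"
  shows "\<exists>t. step3_outer f m A \<rho> k s = Continue t \<and> step3_invariant k t"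
proof -
  define d where "d = (\<lambda>t x. if x < Suc k then full_upto t x else e x)"
  have saved: "saved s t = V (d t)" if "t < k" for t
    using inv that by (simp add: step3_invariant_def d_def)
  let ?s = "s\<lparr>cur := saved s (k - 1)\<rparr>"
  have "for_loop [0..<Suc (m k - \<rho> k)] (step3_inner f A k) ?s =
    Break (?s\<lparr>cur := 0\<^sub>v n, expo := (expo ?s)(k := e k),
      saved := (\<lambda>t. if t < k - 1 then (poly_mat (f k) A ^\<^sub>m (e k - \<rho> k)) *\<^sub>v saved ?s t else saved ?s t)\<rparr>)"
    (is "_ = Break ?t")
  \<comment> \<open>The pass works on v_(k-1), in which only \<open>f k\<close> can still have too
    small an exponent.\<close>
  proof (rule step3_inner_loop[OF k, where d = "d (k - 1)"])
    show "\<forall>t\<in>{1..q} - {k}. e t \<le> d (k - 1) t"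
      using le_mult k by (auto simp: d_def full_upto_def)
    show "cur ?s = V (d (k - 1))" using saved[of "k - 1"] k by simp
    show "d (k - 1) k = \<rho> k" using k by (auto simp: d_def full_upto_def)
    show "expo ?s k = \<rho> k" using inv k by (simp add: step3_invariant_def)
  qed
  hence "step3_outer f m A \<rho> k s = Continue ?t" by (simp add: step3_outer_def)
  moreover have "step3_invariant k ?t"
    unfolding step3_invariant_def
  proof (intro conjI allI impI ballI)
    fix t assume t: "Suc t < k"
    hence "saved ?t t = V ((d t)(k := d t k + (e k - \<rho> k)))"
      by (simp add: saved V_power[OF k])
    \<comment> \<open>As \<open>t < k\<close>, the vector v_t enters this pass with exponent
      \<open>\<rho> k\<close> for \<open>f k\<close>.\<close>
    also have "d t k + (e k - \<rho> k) = e k"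
      using t rho_le[OF k] by (simp add: d_def full_upto_def)
    also have "(d t)(k := e k) = (\<lambda>x. if x < k then full_upto t x else e x)"
      by (auto simp: d_def fun_eq_iff)
    finally show "saved ?t t = V (\<lambda>x. if x < k then full_upto t x else e x)" .
  next
    fix x assume "x \<in> {1..q}"
    thus "expo ?t x = (if x < k then \<rho> x else e x)"
      using inv by (simp add: step3_invariant_def)
  qed
  ultimately show ?thesis by blast
qed

text \<open>If the initial vector is zero, then \<open>e\<close> and \<rho> bound each other.
  Otherwise the end of step (2) establishes the invariant of step (3), whose final instance, at 1,
  leaves no index with a provisional exponent.\<close>

theorem min_annih_column_eq:
  assumes R: "\<rho> = (\<lambda>i. R i j)" and start: "poly_mat (pseudo_poly f q R j) A *\<^sub>v unit_vec n j = V \<rho>"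
    and x: "x \<in> {1..q}"
  shows "min_annih_column f m q A R j x = e x"
proof (cases "V \<rho> = 0\<^sub>v n")
  case True
  hence "e x \<le> \<rho> x" using x unfolding V_zero by blast
  hence "\<rho> x = e x" using rho_le[OF x] by simp
  thus ?thesis using True by (simp add: min_annih_column_def start Let_def R)
next
  case False
  then obtain i s where s:
    "for_loop [1..<Suc q] (step2_outer f m A \<rho>) \<lparr>cur = V \<rho>, saved = (\<lambda>_. V \<rho>), expo = \<rho>, stop = 0\<rparr> = Break s"
    and i: "i \<in> {1..q}" "stop s = i" "\<And>t. t \<in> {1..q} \<Longrightarrow> i < t \<Longrightarrow> e t = \<rho> t"
    and expo: "expo s = \<rho>(i := e i)" and saved: "\<And>k. k < i \<Longrightarrow> saved s k = V ((full_upto k)(i := e i))"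
    by (rule step2_stops) blast
  have "step3_invariant i s"
    unfolding step3_invariant_def
  proof (intro conjI allI impI ballI)
    fix t assume "Suc t < i"
    \<comment> \<open>Beyond \<open>i\<close> the exponents \<rho> and \<open>e\<close> agree only
      within \<open>{1..q}\<close>, which suffices by \<open>V_cong\<close>.\<close>
    thus "saved s t = V (\<lambda>x. if x < i then full_upto t x else e x)"
      using i(3) by (auto simp: saved full_upto_def intro!: V_cong)
  qed (use i(3) in \<open>auto simp: expo\<close>)
  moreover have "1 \<le> i" using i by simp
  ultimately obtain t where t: "for_loop (rev [1..<i]) (step3_outer f m A \<rho>) s = Continue t" "step3_invariant 1 t"
    using for_loop_rev_upt_invariant[of 1 i step3_invariant s "step3_outer f m A \<rho>"]
      step3_outer_invariant i(1) by auto
  have "min_annih_column f m q A R j = expo t"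
    using False s t(1) i(2) by (simp add: min_annih_column_def start Let_def R[symmetric])
  thus ?thesis using t(2) x by (simp add: step3_invariant_def)
qed

end

section \<open>Pseudo annihilating exponents and correctness\<close>

text \<open>When \<open>e < m i\<close>, the annihilation hypothesis makes column \<open>j\<close>
  of \<open>B e\<close> zero. Then entry \<open>j\<close> of the row vector is zero in pass
  \<open>e\<close>, whatever \<open>u\<close> is, and the exponent is set by then at the
  latest.\<close>

lemma pseudo_exps_le:
  fixes A :: "'a::field mat"
  assumes A: "A \<in> carrier_mat n n" and u: "u \<in> carrier_vec n" and j: "j < n"
    and ann: "e < m i \<Longrightarrow> cofactor f m A i * f i ^ e \<in> unit_annihilators A j"
  shows "pseudo_exps f m A u i j \<le> e"
proof -
  let ?F = "poly_mat (f i) A"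
  define B where "B k = poly_mat (cofactor f m A i * f i ^ k) A" for k
  have B: "B k \<in> carrier_mat n n" for k unfolding B_def by (rule poly_mat_carrier[OF A])
  have F: "?F \<in> carrier_mat n n" by (rule poly_mat_carrier[OF A])
  have "B (Suc k) = B k * ?F" for k
    unfolding B_def by (simp add: poly_mat_mult[OF A, symmetric] ac_simps)
  hence B_Suc: "transpose_mat ?F *\<^sub>v (transpose_mat (B k) *\<^sub>v u) = transpose_mat (B (Suc k)) *\<^sub>v u" for k
    using assoc_mult_mat_vec[of "transpose_mat ?F" n n "transpose_mat (B k)" n u] B F u
    by (simp add: transpose_mult[of _ n n _ n])
  have B_zero: "(transpose_mat (B e) *\<^sub>v u) $ j = 0" if "e < m i"
  proof -
    have "col (B e) j = B e *\<^sub>v unit_vec n j"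
      using B[of e] j by (intro eq_vecI) auto
    also have "\<dots> = 0\<^sub>v n" using ann[OF that] A by (simp add: B_def unit_annihilators_def)
    finally show ?thesis using B[of e] j u by simp
  qed
  \<comment> \<open>The last conjunct covers the default value: an exponent still unset after all
    passes forces \<open>m i \<le> e\<close>.\<close>
  define P where "P = (\<lambda>k (b, r :: nat \<Rightarrow> nat option).
    b = transpose_mat (B k) *\<^sub>v u \<and> (\<forall>x. r j = Some x \<longrightarrow> x \<le> e) \<and> (e < k \<longrightarrow> r j \<noteq> None))"
  define Q where "Q = (\<lambda>(b :: 'a vec, r :: nat \<Rightarrow> nat option). \<exists>x\<le>e. r j = Some x)"
  let ?init = "(transpose_mat (poly_mat (cofactor f m A i) A) *\<^sub>v u, \<lambda>_. None) :: 'a vec \<times> (nat \<Rightarrow> nat option)"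
  have "case for_loop [0..<m i] (pseudo_body ?F) ?init of Continue t \<Rightarrow> P (m i) t | Break t \<Rightarrow> Q t"
  proof (rule for_loop_upt_invariant)
    show "P 0 ?init" by (simp add: P_def B_def)
    fix k s assume "k < m i" "P k s"
    obtain b r where s: "s = (b, r)" by (cases s)
    show "case pseudo_body ?F k s of Continue t \<Rightarrow> P (Suc k) t | Break t \<Rightarrow> Q t"
    proof (cases "b = 0\<^sub>v n \<and> (\<forall>j<n. r j \<noteq> None)")
      case True
      then obtain x where "r j = Some x" using j by blast
      thus ?thesis using True \<open>P k s\<close> A by (simp add: s pseudo_body_def P_def Q_def)
    next
      case False
      define r' where "r' = (\<lambda>j. if j < n \<and> r j = None \<and> b $ j = 0 then Some k else r j)"
      have "pseudo_body ?F k s = Continue (transpose_mat ?F *\<^sub>v b, r')"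
        using False A by (auto simp: s pseudo_body_def r'_def)
      moreover have "P (Suc k) (transpose_mat ?F *\<^sub>v b, r')"
      proof -
        have P: "b = transpose_mat (B k) *\<^sub>v u" "\<And>x. r j = Some x \<Longrightarrow> x \<le> e" "e < k \<Longrightarrow> r j \<noteq> None"
          using \<open>P k s\<close> by (auto simp: P_def s)
        have "x \<le> e" if "r' j = Some x" for x
          using that P(2,3) by (auto simp: r'_def not_le[symmetric] split: if_splits)
        moreover have "r' j \<noteq> None" if "e < Suc k"
        proof (cases "e = k")
          case True
          thus ?thesis using B_zero \<open>k < m i\<close> j P(1) by (auto simp: r'_def)
        next
          case False
          thus ?thesis using that P(3) by (auto simp: r'_def)
        qed
        ultimately show ?thesis by (simp add: P_def P(1) B_Suc)
      qed
      ultimately show ?thesis by simp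
    qed
  qed simp
  thus ?thesis
    unfolding pseudo_exps_def Let_def
    by (auto simp: P_def Q_def split: flow.splits option.splits)
qed

theorem proposition5:
  fixes A :: "'a::field_char_0 mat" and u :: "'a vec"
    and f :: "nat \<Rightarrow> 'a poly" and m :: "nat \<Rightarrow> nat" and n q :: nat
  assumes A: "A \<in> carrier_mat n n"
    and monic: "\<And>i. i \<in> {1..q} \<Longrightarrow> lead_coeff (f i) = 1"
    and irred: "\<And>i. i \<in> {1..q} \<Longrightarrow> irreducible (f i)"
    and distinct: "inj_on f {1..q}"
    and mult: "\<And>i. i \<in> {1..q} \<Longrightarrow> m i \<ge> 1"
    and factorization: "char_poly A = (\<Prod>i = 1..q. f i ^ m i)"
    and u: "u \<in> carrier_vec n" "u \<noteq> 0\<^sub>v n"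
  shows "\<forall>j<n. unit_min_annih_poly A j = (\<Prod>i = 1..q. f i ^ min_annih_exps f m q A u i j)"
proof (intro allI impI)
  fix j assume j: "j < n"
  obtain g where g: "monic g" "\<And>p. p \<in> unit_annihilators A j \<longleftrightarrow> g dvd p"
    using unit_annihilators_generator[OF A] by blast
  have "g dvd (\<Prod>i = 1..q. f i ^ m i)"
    using char_poly_unit_annihilators[OF A] g(2) factorization by metis
  then obtain e where e: "\<forall>i\<in>{1..q}. e i \<le> m i" and g_eq: "g = (\<Prod>i = 1..q. f i ^ e i)"
    using monic_dvd_prod_powers[of "{1..q}" f g m] monic irred g(1) by auto
  have ann: "(\<Prod>i = 1..q. f i ^ d i) \<in> unit_annihilators A j \<longleftrightarrow> (\<forall>i\<in>{1..q}. e i \<le> d i)" for d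
    unfolding g(2) g_eq using monic irred distinct by (intro prod_powers_dvd_iff) auto
  define V where "V d = poly_mat (\<Prod>i = 1..q. f i ^ d i) A *\<^sub>v unit_vec n j" for d
  define \<rho> where "\<rho> = (\<lambda>i. pseudo_exps f m A u i j)"
  have upd: "(\<Prod>t = 1..q. f t ^ (d(i := k)) t) = f i ^ k * (\<Prod>t\<in>{1..q} - {i}. f t ^ d t)"
    if "i \<in> {1..q}" for d i k
  proof -
    have "(\<Prod>t\<in>{1..q} - {i}. f t ^ (d(i := k)) t) = (\<Prod>t\<in>{1..q} - {i}. f t ^ d t)"
      by (intro prod.cong) auto
    thus ?thesis by (simp only: prod.remove[OF finite_atLeastAtMost that] fun_upd_same)
  qed
  interpret column_exponents f A m q n \<rho> e V
  proof
    show "A \<in> carrier_mat n n" by (rule A)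
    show "V d \<in> carrier_vec n" for d
      unfolding V_def using poly_mat_carrier[OF A] by (rule mult_mat_vec_carrier) simp
    show "V d = 0\<^sub>v n \<longleftrightarrow> (\<forall>i\<in>{1..q}. e i \<le> d i)" for d
      unfolding ann[symmetric] using A by (simp add: V_def unit_annihilators_def)
    show "V d = V d'" if "\<And>i. i \<in> {1..q} \<Longrightarrow> d i = d' i" for d d'
      using arg_cong[where f = "\<lambda>p. poly_mat p A *\<^sub>v unit_vec n j", OF prod.cong[OF refl, of "{1..q}"]] that
      unfolding V_def by simp
    fix i assume i: "i \<in> {1..q}"
    show "e i \<le> m i" using e i by blast
    show "poly_mat (f i) A *\<^sub>v V d = V (d(i := Suc (d i)))" for d
    proof -
      have "(\<Prod>t = 1..q. f t ^ (d(i := Suc (d i))) t) = f i * (\<Prod>t = 1..q. f t ^ d t)"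
        unfolding upd[OF i] by (simp only: prod.remove[OF finite_atLeastAtMost i] power_Suc mult.assoc)
      thus ?thesis
        unfolding V_def by (simp add: poly_mat_mult[OF A] assoc_mult_mat_vec[of _ n n _ n] poly_mat_carrier[OF A])
    qed
    \<comment> \<open>Lowering \<open>m i\<close> to \<open>e i\<close> in the factorization still
      gives an annihilator, since every other \<open>m t\<close> is at least \<open>e t\<close>;
      this bounds the pseudo exponent.\<close>
    have "char_poly A = f i ^ m i * (\<Prod>t\<in>{1..q} - {i}. f t ^ m t)"
      unfolding factorization using i by (simp add: prod.remove)
    moreover have "f i ^ m i \<noteq> 0" using monic[OF i] by auto
    ultimately have "cofactor f m A i * f i ^ e i = (\<Prod>t = 1..q. f t ^ (m(i := e i)) t)"
      unfolding upd[OF i] by (simp add: Defs.cofactor_def)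
    moreover have "\<dots> \<in> unit_annihilators A j" unfolding ann using e by simp
    ultimately show "\<rho> i \<le> e i"
      unfolding \<rho>_def by (intro pseudo_exps_le[OF A u(1) j]) auto
  qed
  have "min_annih_exps f m q A u i j = e i" if "i \<in> {1..q}" for i
    unfolding min_annih_exps_def
    by (rule min_annih_column_eq[where R = "pseudo_exps f m A u", OF \<rho>_def _ that]) (simp add: V_def pseudo_poly_def \<rho>_def)
  hence "(\<Prod>i = 1..q. f i ^ min_annih_exps f m q A u i j) = g"
    unfolding g_eq by (intro prod.cong) auto
  thus "unit_min_annih_poly A j = (\<Prod>i = 1..q. f i ^ min_annih_exps f m q A u i j)"
    using unit_min_annih_poly_eqI[OF g] by simp
qed

end
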